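(* Let $(M,\omega)$ be a closed symplectic manifold and let $\zeta\colon C(M)\to\mathbb{R}$ be a simple partial symplectic quasi-state on $(M,\omega)$. Then every $\zeta$-pseudoheavy subset of $M$ is $\zeta$-heavy.
   Context: $C(M)$ (resp. $C^\infty(M)$) is the set of continuous (resp. smooth) real-valued functions on $M$. For a (smooth) Hamiltonian $H\colon S^1\times M\to\mathbb{R}$ ($S^1=\mathbb{R}/\mathbb{Z}$, $H_t=H(t,\cdot)$), the Hamiltonian vector field is defined by $\iota_{X_{H_t}}\omega=-dH_t$, and $\varphi_H$ is the time-1 map of its flow; $\mathrm{Ham}(M,\omega)$ is the group of all such $\varphi_H$. A subset $X\subset M$ is displaceable from $Y\subset M$ if there is $H$ with $\varphi_H(X)\cap\overline{Y}=\emptyset$. A partial symplectic quasi-state on $(M,\omega)$ is a functional $\zeta\colon C(M)\to\mathbb{R}$ such that: (Normalization) $\zeta(a)=a$ for every constant function $a$; (Stability) $\min_M(H_1-H_2)\le\zeta(H_1)-\zeta(H_2)\le\max_M(H_1-H_2)$ for all $H_1,H_2\in C(M)$; (Semi-homogeneity) $\zeta(sH)=s\zeta(H)$ for all $H\in C(M)$, $s>0$; (Hamiltonian invariance) $\zeta(H\circ\phi)=\zeta(H)$ for all $H\in C(M)$, $\phi\in\mathrm{Ham}(M,\omega)$; (Vanishing) $\zeta(H)=0$ for every $H\in C(M)$ whose support is displaceable from itself; (Quasi-subadditivity) $\zeta(H_1+H_2)\le\zeta(H_1)+\zeta(H_2)$ for all $H_1,H_2\in C^\infty(M)$ with $\{H_1,H_2\}=0$.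 For an open $U\subset M$, $\mathcal{H}(U)$ is the set of functions in $C(M)$ whose support is contained in $U$. A closed subset $X\subset M$ is $\zeta$-pseudoheavy if for every open neighborhood $U$ of $X$ there exists $F\in\mathcal{H}(U)$ with $\zeta(F)>0$. A closed subset $X\subset M$ is $\zeta$-heavy if $\zeta(H)\ge\inf_X H$ for every $H\in C(M)$. For a closed subset $X\subset M$, $\tau_\zeta(X)=\inf\{\zeta(a)\mid a\colon M\to[0,1]\text{ continuous},\ a|_X\equiv 1\}$. The partial symplectic quasi-state $\zeta$ is simple if $\tau_\zeta(X)\in\{0,1\}$ for every closed subset $X\subset M$. *)

theory Defs
  imports "HOL-Analysis.Analysis"
begin

section \<open>Smooth manifolds\<close>

text \<open>Smoothness is used only on open subsets of finite-dimensional spaces, where having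
  continuous directional derivatives of all orders is the usual notion.\<close>

primrec k_smooth_on ::
    "nat \<Rightarrow> 'e::real_normed_vector set \<Rightarrow> ('e \<Rightarrow> 'f::real_normed_vector) \<Rightarrow> bool" where
  "k_smooth_on 0 S f \<longleftrightarrow> continuous_on S f"
| "k_smooth_on (Suc k) S f \<longleftrightarrow>
     (\<forall>x\<in>S. f differentiable (at x)) \<and>
     (\<forall>v. k_smooth_on k S (\<lambda>x. frechet_derivative f (at x) v))"

definition smooth_on :: "'e::real_normed_vector set \<Rightarrow> ('e \<Rightarrow> 'f::real_normed_vector) \<Rightarrow> bool" where
  "smooth_on S f \<longleftrightarrow> (\<forall>k. k_smooth_on k S f)"

text \<open>A chart is a pair \<open>(U, \<phi>)\<close>; the values of \<open>\<phi>\<close> outside \<open>U\<close> are irrelevant.\<close>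

type_synonym ('a, 'e) chart = "'a set \<times> ('a \<Rightarrow> 'e)"

definition is_chart :: "('a::topological_space, 'e::real_normed_vector) chart \<Rightarrow> bool" where
  "is_chart c \<longleftrightarrow> (case c of (U, \<phi>) \<Rightarrow>
     open U \<and> open (\<phi> ` U) \<and> homeomorphism U (\<phi> ` U) \<phi> (inv_into U \<phi>))"

text \<open>The manifold is the whole type \<open>'a\<close>. The model space \<open>'e\<close> is an arbitrary
  finite-dimensional normed space rather than a \<open>euclidean_space\<close>, since the latter class
  excludes dimension 0. The atlas need not be maximal.\<close>

definition smooth_atlas ::
    "('a::{t2_space,second_countable_topology}, 'e::real_normed_vector) chart set \<Rightarrow> bool" where
  "smooth_atlas A \<longleftrightarrow>
     (\<exists>B::'e set. finite B \<and> span B = UNIV) \<and>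
     (\<forall>c\<in>A. is_chart c) \<and>
     (\<Union>(fst ` A) = UNIV) \<and>
     (\<forall>(U, \<phi>)\<in>A. \<forall>(V, \<psi>)\<in>A. smooth_on (\<phi> ` (U \<inter> V)) (\<psi> \<circ> inv_into U \<phi>))"

definition smooth_functions ::
    "('a, 'e::real_normed_vector) chart set \<Rightarrow> ('a \<Rightarrow> real) set" where
  "smooth_functions A = {f. \<forall>(U, \<phi>)\<in>A. smooth_on (\<phi> ` U) (f \<circ> inv_into U \<phi>)}"

text \<open>Tangent vectors at \<open>p\<close> are the derivations at \<open>p\<close> of the algebra of smooth functions.
  They are set to 0 on non-smooth functions, so that equality of tangent vectors is equality
  in HOL. The differential is then \<open>dH(v) = v H\<close>.\<close>

type_synonym 'a tangent_vector = "('a \<Rightarrow> real) \<Rightarrow> real"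

definition tangent_space ::
    "('a, 'e::real_normed_vector) chart set \<Rightarrow> 'a \<Rightarrow> 'a tangent_vector set" where
  "tangent_space A p = {v.
     (\<forall>f\<in>smooth_functions A. \<forall>g\<in>smooth_functions A. v (\<lambda>x. f x + g x) = v f + v g) \<and>
     (\<forall>f\<in>smooth_functions A. \<forall>c. v (\<lambda>x. c * f x) = c * v f) \<and>
     (\<forall>f\<in>smooth_functions A. \<forall>g\<in>smooth_functions A.
        v (\<lambda>x. f x * g x) = f p * v g + g p * v f) \<and>
     (\<forall>f. f \<notin> smooth_functions A \<longrightarrow> v f = 0)}"

type_synonym 'a vector_field = "'a \<Rightarrow> 'a tangent_vector"

definition smooth_vector_fields ::
    "('a, 'e::real_normed_vector) chart set \<Rightarrow> 'a vector_field set" where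
  "smooth_vector_fields A = {X.
     (\<forall>p. X p \<in> tangent_space A p) \<and>
     (\<forall>f\<in>smooth_functions A. (\<lambda>p. X p f) \<in> smooth_functions A)}"

definition lie_bracket ::
    "('a, 'e::real_normed_vector) chart set \<Rightarrow> 'a vector_field \<Rightarrow> 'a vector_field \<Rightarrow> 'a vector_field"
  where
  "lie_bracket A X Y = (\<lambda>p f.
     if f \<in> smooth_functions A then X p (\<lambda>q. Y q f) - Y p (\<lambda>q. X q f) else 0)"

section \<open>Symplectic forms\<close>

type_synonym 'a two_form = "'a \<Rightarrow> 'a tangent_vector \<Rightarrow> 'a tangent_vector \<Rightarrow> real"

definition smooth_two_form ::
    "('a, 'e::real_normed_vector) chart set \<Rightarrow> 'a two_form \<Rightarrow> bool" where
  "smooth_two_form A \<omega> \<longleftrightarrow>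
     (\<forall>p. \<forall>u\<in>tangent_space A p. \<forall>v\<in>tangent_space A p. \<forall>w\<in>tangent_space A p. \<forall>a b.
        \<omega> p (\<lambda>f. a * u f + b * v f) w = a * \<omega> p u w + b * \<omega> p v w \<and>
        \<omega> p w (\<lambda>f. a * u f + b * v f) = a * \<omega> p w u + b * \<omega> p w v) \<and>
     (\<forall>p. \<forall>v\<in>tangent_space A p. \<omega> p v v = 0) \<and>
     (\<forall>X\<in>smooth_vector_fields A. \<forall>Y\<in>smooth_vector_fields A.
        (\<lambda>p. \<omega> p (X p) (Y p)) \<in> smooth_functions A)"

text \<open>Invariant formula for the exterior derivative of a 2-form.\<close>

definition exterior_derivative ::
    "('a, 'e::real_normed_vector) chart set \<Rightarrow> 'a two_form \<Rightarrow>
     'a vector_field \<Rightarrow> 'a vector_field \<Rightarrow> 'a vector_field \<Rightarrow> 'a \<Rightarrow> real" where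
  "exterior_derivative A \<omega> X Y Z p =
     X p (\<lambda>q. \<omega> q (Y q) (Z q)) - Y p (\<lambda>q. \<omega> q (X q) (Z q)) + Z p (\<lambda>q. \<omega> q (X q) (Y q))
     - \<omega> p (lie_bracket A X Y p) (Z p)
     + \<omega> p (lie_bracket A X Z p) (Y p)
     - \<omega> p (lie_bracket A Y Z p) (X p)"

definition closed_two_form ::
    "('a, 'e::real_normed_vector) chart set \<Rightarrow> 'a two_form \<Rightarrow> bool" where
  "closed_two_form A \<omega> \<longleftrightarrow>
     (\<forall>X\<in>smooth_vector_fields A. \<forall>Y\<in>smooth_vector_fields A. \<forall>Z\<in>smooth_vector_fields A. \<forall>p.
        exterior_derivative A \<omega> X Y Z p = 0)"

definition nondegenerate_two_form ::
    "('a, 'e::real_normed_vector) chart set \<Rightarrow> 'a two_form \<Rightarrow> bool" where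
  "nondegenerate_two_form A \<omega> \<longleftrightarrow>
     (\<forall>p. \<forall>u\<in>tangent_space A p. (\<forall>v\<in>tangent_space A p. \<omega> p u v = 0) \<longrightarrow> u = (\<lambda>f. 0))"

definition closed_symplectic_manifold ::
    "('a::{t2_space,second_countable_topology}, 'e::real_normed_vector) chart set \<Rightarrow>
     'a two_form \<Rightarrow> bool" where
  "closed_symplectic_manifold A \<omega> \<longleftrightarrow>
     compact (UNIV :: 'a set) \<and> smooth_atlas A \<and>
     smooth_two_form A \<omega> \<and> closed_two_form A \<omega> \<and> nondegenerate_two_form A \<omega>"

section \<open>Hamiltonian dynamics\<close>

text \<open>A smooth function on \<open>S\<^sup>1 \<times> M\<close> with \<open>S\<^sup>1 = \<real>/\<int>\<close> is represented by a smooth function on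
  \<open>\<real> \<times> M\<close> which is 1-periodic in the first argument.\<close>

definition hamiltonians ::
    "('a, 'e::real_normed_vector) chart set \<Rightarrow> (real \<Rightarrow> 'a \<Rightarrow> real) set" where
  "hamiltonians A = {H.
     (\<forall>t. H (t + 1) = H t) \<and>
     (\<forall>(U, \<phi>)\<in>A. smooth_on (UNIV \<times> \<phi> ` U) (\<lambda>(t, x). H t (inv_into U \<phi> x)))}"

definition ham_vector_field ::
    "('a, 'e::real_normed_vector) chart set \<Rightarrow> 'a two_form \<Rightarrow> ('a \<Rightarrow> real) \<Rightarrow> 'a vector_field" where
  "ham_vector_field A \<omega> F p =
     (THE v. v \<in> tangent_space A p \<and> (\<forall>w\<in>tangent_space A p. \<omega> p v w = - w F))"

text \<open>The flow equation \<open>d/dt \<phi>\<^sub>t(x) = X\<^sub>t(\<phi>\<^sub>t(x))\<close>, tested against smooth functions.\<close>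

definition is_ham_flow ::
    "('a, 'e::real_normed_vector) chart set \<Rightarrow> 'a two_form \<Rightarrow> (real \<Rightarrow> 'a \<Rightarrow> real) \<Rightarrow>
     (real \<Rightarrow> 'a \<Rightarrow> 'a) \<Rightarrow> bool" where
  "is_ham_flow A \<omega> H \<phi> \<longleftrightarrow>
     (\<forall>x. \<phi> 0 x = x) \<and>
     (\<forall>f\<in>smooth_functions A. \<forall>x t.
        ((\<lambda>s. f (\<phi> s x)) has_real_derivative ham_vector_field A \<omega> (H t) (\<phi> t x) f) (at t))"

definition Ham ::
    "('a, 'e::real_normed_vector) chart set \<Rightarrow> 'a two_form \<Rightarrow> ('a \<Rightarrow> 'a) set" where
  "Ham A \<omega> = {\<phi> 1 |H \<phi>. H \<in> hamiltonians A \<and> is_ham_flow A \<omega> H \<phi>}"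

text \<open>Only the vanishing of the Poisson bracket is used below, so its sign convention is
  immaterial.\<close>

definition poisson_bracket ::
    "('a, 'e::real_normed_vector) chart set \<Rightarrow> 'a two_form \<Rightarrow>
     ('a \<Rightarrow> real) \<Rightarrow> ('a \<Rightarrow> real) \<Rightarrow> 'a \<Rightarrow> real" where
  "poisson_bracket A \<omega> F G p = \<omega> p (ham_vector_field A \<omega> F p) (ham_vector_field A \<omega> G p)"

definition displaceable_from ::
    "('a::{t2_space,second_countable_topology}, 'e::real_normed_vector) chart set \<Rightarrow> 'a two_form \<Rightarrow>
     'a set \<Rightarrow> 'a set \<Rightarrow> bool" where
  "displaceable_from A \<omega> X Y \<longleftrightarrow> (\<exists>\<phi>\<in>Ham A \<omega>. \<phi> ` X \<inter> closure Y = {})"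

section \<open>Partial symplectic quasi-states\<close>

definition continuous_functions :: "('a::topological_space \<Rightarrow> real) set" where
  "continuous_functions = {f. continuous_on UNIV f}"

definition supp :: "('a::topological_space \<Rightarrow> real) \<Rightarrow> 'a set" where
  "supp f = closure {x. f x \<noteq> 0}"

text \<open>A functional on \<open>C(M)\<close> is a functional on all functions, of which only the values on
  continuous functions are ever used. On a compact space, the \<open>INF\<close> and \<open>SUP\<close> of a continuous
  function are its minimum and maximum.\<close>

definition partial_symplectic_quasi_state ::
    "('a::{t2_space,second_countable_topology}, 'e::real_normed_vector) chart set \<Rightarrow> 'a two_form \<Rightarrow>
     (('a \<Rightarrow> real) \<Rightarrow> real) \<Rightarrow> bool" where
  "partial_symplectic_quasi_state A \<omega> \<zeta> \<longleftrightarrow>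
     (\<forall>a. \<zeta> (\<lambda>x. a) = a) \<and>
     (\<forall>H\<^sub>1\<in>continuous_functions. \<forall>H\<^sub>2\<in>continuous_functions.
        (INF x. H\<^sub>1 x - H\<^sub>2 x) \<le> \<zeta> H\<^sub>1 - \<zeta> H\<^sub>2 \<and> \<zeta> H\<^sub>1 - \<zeta> H\<^sub>2 \<le> (SUP x. H\<^sub>1 x - H\<^sub>2 x)) \<and>
     (\<forall>H\<in>continuous_functions. \<forall>s>0. \<zeta> (\<lambda>x. s * H x) = s * \<zeta> H) \<and>
     (\<forall>H\<in>continuous_functions. \<forall>\<phi>\<in>Ham A \<omega>. \<zeta> (H \<circ> \<phi>) = \<zeta> H) \<and>
     (\<forall>H\<in>continuous_functions. displaceable_from A \<omega> (supp H) (supp H) \<longrightarrow> \<zeta> H = 0) \<and>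
     (\<forall>H\<^sub>1\<in>smooth_functions A. \<forall>H\<^sub>2\<in>smooth_functions A.
        (\<forall>p. poisson_bracket A \<omega> H\<^sub>1 H\<^sub>2 p = 0) \<longrightarrow> \<zeta> (\<lambda>x. H\<^sub>1 x + H\<^sub>2 x) \<le> \<zeta> H\<^sub>1 + \<zeta> H\<^sub>2)"

definition supported_in :: "'a::topological_space set \<Rightarrow> ('a \<Rightarrow> real) set" where
  "supported_in U = {F \<in> continuous_functions. supp F \<subseteq> U}"

definition pseudoheavy :: "(('a::topological_space \<Rightarrow> real) \<Rightarrow> real) \<Rightarrow> 'a set \<Rightarrow> bool" where
  "pseudoheavy \<zeta> X \<longleftrightarrow>
     closed X \<and> (\<forall>U. open U \<and> X \<subseteq> U \<longrightarrow> (\<exists>F\<in>supported_in U. \<zeta> F > 0))"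

text \<open>The infimum is taken in the extended reals, so that the infimum over the empty set
  is \<open>\<infinity>\<close>; the infimum over the empty set in \<open>real\<close> would be an unspecified number.\<close>

definition heavy :: "(('a::topological_space \<Rightarrow> real) \<Rightarrow> real) \<Rightarrow> 'a set \<Rightarrow> bool" where
  "heavy \<zeta> X \<longleftrightarrow>
     closed X \<and> (\<forall>H\<in>continuous_functions. ereal (\<zeta> H) \<ge> (INF x\<in>X. ereal (H x)))"

definition tau :: "(('a::topological_space \<Rightarrow> real) \<Rightarrow> real) \<Rightarrow> 'a set \<Rightarrow> real" where
  "tau \<zeta> X =
     Inf {\<zeta> a |a. a \<in> continuous_functions \<and> range a \<subseteq> {0..1} \<and> (\<forall>x\<in>X. a x = 1)}"

definition simple_functional :: "(('a::topological_space \<Rightarrow> real) \<Rightarrow> real) \<Rightarrow> bool" where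
  "simple_functional \<zeta> \<longleftrightarrow> (\<forall>X. closed X \<longrightarrow> tau \<zeta> X \<in> {0, 1})"

end

theory Submission
  imports Defs
begin

text \<open>The properties of \<open>\<zeta>\<close> behind the result are that it is monotone, commutes with adding
  constants and is positively homogeneous.

  Pseudoheaviness of \<open>X\<close> gives every closed neighbourhood \<open>K\<close> of \<open>X\<close> positive
  \<open>\<tau>\<^sub>\<zeta>\<close>, because a function with positive \<open>\<zeta>\<close> supported in \<open>K\<close> can be
  scaled to lie below every cutoff that is \<open>1\<close> on \<open>K\<close>. Simplicity upgrades positivity to
  equality with \<open>1\<close>: \<open>\<zeta> a \<ge> 1\<close> for every cutoff \<open>a\<close> of \<open>K\<close>
  (\<open>pseudoheavy_imp_cutoff_ge_1\<close>). This suffices for heaviness: for \<open>d\<close> below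
  \<open>inf\<^sub>X H\<close>, the set \<open>{H \<ge> d}\<close> is such a neighbourhood, and truncating \<open>H\<close> from above
  at \<open>d\<close> and rescaling affinely gives a cutoff of it, so \<open>\<zeta> H \<ge> d\<close>.\<close>

lemma psqs_mono:
  assumes \<zeta>: "partial_symplectic_quasi_state A \<omega> \<zeta>"
    and "continuous_on UNIV f" "continuous_on UNIV g" and le: "\<And>x. f x \<le> g x"
  shows "\<zeta> f \<le> \<zeta> g"
proof -
  have "0 \<le> (INF x. g x - f x)"
    by (rule cINF_greatest) (auto simp: le)
  also have "\<dots> \<le> \<zeta> g - \<zeta> f"
    using assms by (simp add: partial_symplectic_quasi_state_def continuous_functions_def)
  finally show ?thesis by simp
qed

text \<open>Stability is an equality when the two functions differ by a constant, as the minimum and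
  the maximum of the difference then agree.\<close>

lemma psqs_add_const:
  assumes \<zeta>: "partial_symplectic_quasi_state A \<omega> \<zeta>" and f: "continuous_on UNIV f"
  shows "\<zeta> (\<lambda>x. f x + c) = \<zeta> f + c"
proof -
  have "continuous_on UNIV (\<lambda>x. f x + c)"
    using f by (intro continuous_intros)
  then have mem: "(\<lambda>x. f x + c) \<in> continuous_functions" "f \<in> continuous_functions"
    using f by (simp_all add: continuous_functions_def)
  have "\<forall>H\<^sub>1\<in>continuous_functions. \<forall>H\<^sub>2\<in>continuous_functions.
      (INF x. H\<^sub>1 x - H\<^sub>2 x) \<le> \<zeta> H\<^sub>1 - \<zeta> H\<^sub>2 \<and> \<zeta> H\<^sub>1 - \<zeta> H\<^sub>2 \<le> (SUP x. H\<^sub>1 x - H\<^sub>2 x)"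
    using \<zeta> unfolding partial_symplectic_quasi_state_def by (elim conjE)
  from this[THEN bspec, OF mem(1), THEN bspec, OF mem(2)] show ?thesis by simp
qed

lemma psqs_scale:
  assumes "partial_symplectic_quasi_state A \<omega> \<zeta>" "continuous_on UNIV f" "s > 0"
  shows "\<zeta> (\<lambda>x. s * f x) = s * \<zeta> f"
  using assms by (simp add: partial_symplectic_quasi_state_def continuous_functions_def)

lemma psqs_const:
  assumes "partial_symplectic_quasi_state A \<omega> \<zeta>"
  shows "\<zeta> (\<lambda>x. c) = c"
  using assms by (simp add: partial_symplectic_quasi_state_def)

lemma continuous_real_bounds_on_compact_space:
  fixes f :: "'a::topological_space \<Rightarrow> real"
  assumes "compact (UNIV :: 'a set)" "continuous_on UNIV f"
  obtains b where "b > 0" "\<And>x. \<bar>f x\<bar> \<le> b"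
proof -
  have "bounded (range f)"
    using assms by (intro compact_imp_bounded compact_continuous_image)
  then show ?thesis
    using that by (auto simp: bounded_pos)
qed

lemma tau_le:
  assumes \<zeta>: "partial_symplectic_quasi_state A \<omega> \<zeta>"
    and a: "continuous_on UNIV a" "range a \<subseteq> {0..1}" "\<And>x. x \<in> K \<Longrightarrow> a x = 1"
  shows "tau \<zeta> K \<le> \<zeta> a"
  unfolding tau_def
proof (rule cInf_lower)
  have "0 \<le> \<zeta> b" if "continuous_on UNIV b" "range b \<subseteq> {0..1}" for b
    using psqs_mono[OF \<zeta>, of "\<lambda>x. 0" b] psqs_const[OF \<zeta>, of 0] that
    by (auto simp: image_subset_iff)
  then show "bdd_below {\<zeta> a |a. a \<in> continuous_functions \<and> range a \<subseteq> {0..1} \<and> (\<forall>x\<in>K. a x = 1)}"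
    by (intro bdd_belowI[of _ 0]) (auto simp: continuous_functions_def)
qed (use a in \<open>auto simp: continuous_functions_def\<close>)

text \<open>A function \<open>F\<close> supported in \<open>K\<close> vanishes off \<open>K\<close>, where a cutoff \<open>a\<close> of \<open>K\<close> is
  nonnegative. Hence \<open>F / b \<le> a\<close> for any positive upper bound \<open>b\<close> of \<open>F\<close>, so \<open>\<tau>\<^sub>\<zeta>(K) \<ge> \<zeta> F / b\<close>, which is
  positive and does not depend on \<open>a\<close>.\<close>

lemma tau_pos:
  fixes \<zeta> :: "('a::{t2_space,second_countable_topology} \<Rightarrow> real) \<Rightarrow> real"
  assumes "compact (UNIV :: 'a set)"
    and \<zeta>: "partial_symplectic_quasi_state A \<omega> \<zeta>"
    and F: "F \<in> supported_in K" "\<zeta> F > 0"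
  shows "tau \<zeta> K > 0"
proof -
  have F0: "F x = 0" if "x \<notin> K" for x
    using F(1) that closure_subset[of "{x. F x \<noteq> 0}"]
    by (auto simp: supported_in_def supp_def)
  have contF: "continuous_on UNIV F"
    using F(1) by (simp add: supported_in_def continuous_functions_def)
  obtain b where b: "b > 0" "\<And>x. \<bar>F x\<bar> \<le> b"
    using continuous_real_bounds_on_compact_space[OF assms(1) contF] by blast
  have "\<zeta> F / b \<le> tau \<zeta> K"
    unfolding tau_def
  proof (rule cInf_greatest)
    have "\<zeta> (\<lambda>x. 1) \<in> {\<zeta> a |a. a \<in> continuous_functions \<and> range a \<subseteq> {0..1} \<and> (\<forall>x\<in>K. a x = 1)}"
      by (auto simp: continuous_functions_def)
    then show "{\<zeta> a |a. a \<in> continuous_functions \<and> range a \<subseteq> {0..1} \<and> (\<forall>x\<in>K. a x = 1)} \<noteq> {}"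
      by blast
  next
    fix t
    assume "t \<in> {\<zeta> a |a. a \<in> continuous_functions \<and> range a \<subseteq> {0..1} \<and> (\<forall>x\<in>K. a x = 1)}"
    then obtain a where t: "t = \<zeta> a" and a: "continuous_on UNIV a" "\<And>x. 0 \<le> a x" "\<And>x. x \<in> K \<Longrightarrow> a x = 1"
      by (auto simp: continuous_functions_def image_subset_iff)
    have le: "F x \<le> b * a x" for x
    proof (cases "x \<in> K")
      case True
      then show ?thesis using a(3) b(2)[of x] by simp
    next
      case False
      then show ?thesis using F0 a(2) b(1) by simp
    qed
    have "\<zeta> F \<le> \<zeta> (\<lambda>x. b * a x)"
      using contF a(1) le by (intro psqs_mono[OF \<zeta>] continuous_intros)
    also have "\<dots> = b * \<zeta> a"
      by (rule psqs_scale[OF \<zeta> a(1) b(1)])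
    finally show "\<zeta> F / b \<le> t"
      using b(1) by (simp add: t field_simps)
  qed
  moreover have "\<zeta> F / b > 0"
    using F(2) b(1) by simp
  ultimately show ?thesis by linarith
qed

text \<open>Pseudoheaviness speaks of functions supported in an open neighbourhood of \<open>X\<close>, whereas
  simplicity needs a closed set. Taking \<open>K\<close> closed with \<open>X\<close> in its interior serves both:
  a function supported in \<open>interior K\<close> makes \<open>\<tau>\<^sub>\<zeta>(K)\<close> positive, hence equal to \<open>1\<close>.\<close>

lemma pseudoheavy_imp_cutoff_ge_1:
  fixes \<zeta> :: "('a::{t2_space,second_countable_topology} \<Rightarrow> real) \<Rightarrow> real"
  assumes "compact (UNIV :: 'a set)"
    and \<zeta>: "partial_symplectic_quasi_state A \<omega> \<zeta>"
    and "simple_functional \<zeta>" and "pseudoheavy \<zeta> X"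
    and K: "closed K" "X \<subseteq> interior K"
    and a: "continuous_on UNIV a" "range a \<subseteq> {0..1}" "\<And>x. x \<in> K \<Longrightarrow> a x = 1"
  shows "\<zeta> a \<ge> 1"
proof -
  obtain F where "F \<in> supported_in (interior K)" "\<zeta> F > 0"
    using \<open>pseudoheavy \<zeta> X\<close> K(2) open_interior unfolding pseudoheavy_def by blast
  moreover from this have "F \<in> supported_in K"
    using interior_subset by (auto simp: supported_in_def)
  ultimately have "tau \<zeta> K > 0"
    using tau_pos[OF assms(1) \<zeta>] by blast
  then have "tau \<zeta> K = 1"
    using \<open>simple_functional \<zeta>\<close> K(1) by (auto simp: simple_functional_def)
  then show ?thesis
    using tau_le[OF \<zeta> a, of K] by simp
qed

theorem proposition1p8:
  fixes A :: "('a::{t2_space,second_countable_topology}, 'e::real_normed_vector) chart set"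
    and \<omega> :: "'a two_form"
    and \<zeta> :: "('a \<Rightarrow> real) \<Rightarrow> real"
    and X :: "'a set"
  assumes "closed_symplectic_manifold A \<omega>"
    and "partial_symplectic_quasi_state A \<omega> \<zeta>"
    and "simple_functional \<zeta>"
    and "pseudoheavy \<zeta> X"
  shows "heavy \<zeta> X"
  unfolding heavy_def
proof (intro conjI ballI)
  note \<zeta> = assms(2)
  have comp: "compact (UNIV :: 'a set)"
    using assms(1) by (simp add: closed_symplectic_manifold_def)
  show "closed X"
    using assms(4) by (simp add: pseudoheavy_def)
  fix H :: "'a \<Rightarrow> real"
  assume "H \<in> continuous_functions"
  then have H: "continuous_on UNIV H"
    by (simp add: continuous_functions_def)
  obtain b where b: "\<And>x. \<bar>H x\<bar> \<le> b"
    using continuous_real_bounds_on_compact_space[OF comp H] by blast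
  define m where "m = - b"
  have m: "m \<le> H x" for x
    using b[of x] by (simp add: m_def)
  show "(INF x\<in>X. ereal (H x)) \<le> ereal (\<zeta> H)"
  proof (rule ccontr)
    assume "\<not> (INF x\<in>X. ereal (H x)) \<le> ereal (\<zeta> H)"
    then have "ereal (\<zeta> H) < (INF x\<in>X. ereal (H x))"
      by (simp only: not_le)
    \<comment> \<open>A level strictly below the infimum puts \<open>X\<close> in the interior of \<open>{H \<ge> d}\<close>. It is finite
      also for \<open>X = {}\<close>, where the infimum is \<open>\<infinity>\<close>, so that case is covered as well.\<close>
    from ereal_dense2[OF this]
    obtain d where "ereal (\<zeta> H) < ereal d" and dX: "ereal d < (INF x\<in>X. ereal (H x))"
      by blast
    then have d: "\<zeta> H < d"
      by simp
    have "m \<le> \<zeta> H"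
      using psqs_mono[OF \<zeta> _ H, of "\<lambda>x. m"] m psqs_const[OF \<zeta>, of m] by simp
    with d have md: "m < d"
      by simp
    define K where "K = {x. d \<le> H x}"
    have "closed K"
      unfolding K_def using H by (intro closed_Collect_le continuous_intros)
    moreover have "X \<subseteq> interior K"
    proof (rule interior_maximal[THEN subset_trans[rotated]])
      show "open {x. d < H x}"
        using H by (intro open_Collect_less continuous_intros)
      show "{x. d < H x} \<subseteq> K"
        by (auto simp: K_def)
      show "X \<subseteq> {x. d < H x}"
      proof
        fix x assume "x \<in> X"
        then have "(INF x\<in>X. ereal (H x)) \<le> ereal (H x)"
          by (rule INF_lower)
        with dX have "ereal d < ereal (H x)"
          by (rule less_le_trans)
        then show "x \<in> {x. d < H x}" by simp
      qed
    qed
    moreover define a where "a = (\<lambda>x. min 1 ((H x - m) / (d - m)))"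
    moreover have conta: "continuous_on UNIV a"
      unfolding a_def using H md by (intro continuous_intros) auto
    moreover have "range a \<subseteq> {0..1}"
      using m md by (auto simp: a_def)
    moreover have "a x = 1" if "x \<in> K" for x
      using that md by (simp add: a_def K_def min_def field_simps)
    ultimately have "1 \<le> \<zeta> a"
      using pseudoheavy_imp_cutoff_ge_1[OF comp \<zeta> assms(3,4)] by blast
    then have "(d - m) * 1 \<le> (d - m) * \<zeta> a"
      using md by (intro mult_left_mono) auto
    then have "d \<le> (d - m) * \<zeta> a + m"
      by (simp only: mult_1_right diff_le_eq)
    also have "\<dots> = \<zeta> (\<lambda>x. (d - m) * a x) + m"
      using psqs_scale[OF \<zeta> conta, of "d - m"] md by simp
    also have "\<dots> = \<zeta> (\<lambda>x. (d - m) * a x + m)"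
      using conta by (intro psqs_add_const[OF \<zeta>, symmetric] continuous_intros)
    also have "\<dots> \<le> \<zeta> H"
    proof (rule psqs_mono[OF \<zeta> _ H])
      show "continuous_on UNIV (\<lambda>x. (d - m) * a x + m)"
        using conta by (intro continuous_intros)
      \<comment> \<open>The left-hand side is \<open>min d (H x)\<close>.\<close>
      show "(d - m) * a x + m \<le> H x" for x
        using md mult_left_mono[of "a x" "(H x - m) / (d - m)" "d - m"] by (simp add: a_def)
    qed
    finally show False
      using d by simp
  qed
qed

end
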